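(* Let $R\subseteq S$ be an extension of integral domains and let $G$ be a finite subgroup of $\mathrm{Aut}(S)$ such that $\sigma(R)\subseteq R$ for all $\sigma\in G$. If $(R,S)$ is a GD-pair, then $(R^G,S^G)$ is also a GD-pair.
   Context: All rings are commutative with unity, and subrings share the unity. $\mathrm{Aut}(S)$ is the group of ring automorphisms of $S$. $S^G=\{s\in S : \sigma(s)=s \text{ for all } \sigma\in G\}$ and $R^G=\{r\in R : \sigma(r)=r \text{ for all } \sigma\in G\}=R\cap S^G$. A ring extension $A\subseteq T$ satisfies Going-Down if, whenever $\mathfrak{p}_1\subseteq\mathfrak{p}_2$ are prime ideals of $A$ and $\mathfrak{q}_2$ is a prime ideal of $T$ with $\mathfrak{q}_2\cap A=\mathfrak{p}_2$, there exists a prime ideal $\mathfrak{q}_1\subseteq\mathfrak{q}_2$ of $T$ with $\mathfrak{q}_1\cap A=\mathfrak{p}_1$. A pair of integral domains $(R,S)$ with $R\subseteq S$ is a Going-Down pair (GD-pair) if the extension $R\subseteq T$ satisfies Going-Down for each intermediate ring $R\subseteq T\subseteq S$. *)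

theory Defs
  imports "HOL-Algebra.Algebra"
begin

text \<open>
  A ring extension is given by the big ring as a record \<open>T\<close> and the small one as a subset \<open>A\<close> of
  its carrier; the small ring is then \<open>T\<lparr>carrier := A\<rparr>\<close>. Subrings in HOL-Algebra contain the unity
  of the ambient ring.
\<close>

text \<open>As in \<^theory>\<open>HOL-Algebra.Bij\<close>, automorphisms are extensional functions, so that two
  automorphisms that agree on the carrier are equal.\<close>

definition ring_auto :: "('a, 'b) ring_scheme \<Rightarrow> ('a \<Rightarrow> 'a) set"
  where "ring_auto S = ring_hom S S \<inter> Bij (carrier S)"

definition RingAutoGroup :: "('a, 'b) ring_scheme \<Rightarrow> ('a \<Rightarrow> 'a) monoid"
  where "RingAutoGroup S = BijGroup (carrier S) \<lparr>carrier := ring_auto S\<rparr>"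

definition fixed_points :: "('a \<Rightarrow> 'a) set \<Rightarrow> 'a set \<Rightarrow> 'a set"
  where "fixed_points G A = {a \<in> A. \<forall>\<sigma>\<in>G. \<sigma> a = a}"

definition going_down :: "'a set \<Rightarrow> ('a, 'b) ring_scheme \<Rightarrow> bool"
  where "going_down A T \<longleftrightarrow>
    (\<forall>p1 p2 q2.
       primeideal p1 (T\<lparr>carrier := A\<rparr>) \<and> primeideal p2 (T\<lparr>carrier := A\<rparr>) \<and> p1 \<subseteq> p2 \<and>
       primeideal q2 T \<and> q2 \<inter> A = p2 \<longrightarrow>
       (\<exists>q1. primeideal q1 T \<and> q1 \<subseteq> q2 \<and> q1 \<inter> A = p1))"

definition GD_pair :: "'a set \<Rightarrow> ('a, 'b) ring_scheme \<Rightarrow> bool"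
  where "GD_pair R S \<longleftrightarrow>
    domain S \<and> subdomain R S \<and>
    (\<forall>T. subring T S \<and> R \<subseteq> T \<longrightarrow> going_down R (S\<lparr>carrier := T\<rparr>))"

lemma (in ring) subgroup_ring_auto: "subgroup (ring_auto R) (BijGroup (carrier R))"
proof (rule subgroup.intro)
  show "ring_auto R \<subseteq> carrier (BijGroup (carrier R))"
    by (auto simp: ring_auto_def BijGroup_def)
next
  fix x y
  assume xy: "x \<in> ring_auto R" "y \<in> ring_auto R"
  then have "compose (carrier R) x y \<in> ring_hom R R"
    by (intro ring_hom_memI)
       (auto simp: ring_auto_def compose_def ring_hom_closed ring_hom_mult ring_hom_add ring_hom_one)
  with xy show "x \<otimes>\<^bsub>BijGroup (carrier R)\<^esub> y \<in> ring_auto R"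
    by (simp add: BijGroup_def ring_auto_def compose_Bij)
next
  have "(\<lambda>x\<in>carrier R. x) \<in> ring_hom R R"
    by (rule ring_hom_memI) auto
  then show "\<one>\<^bsub>BijGroup (carrier R)\<^esub> \<in> ring_auto R"
    by (simp add: BijGroup_def ring_auto_def id_Bij)
next
  fix x
  assume "x \<in> ring_auto R"
  then have x: "x \<in> ring_hom R R" "x \<in> Bij (carrier R)"
    by (auto simp: ring_auto_def)
  let ?y = "\<lambda>a\<in>carrier R. inv_into (carrier R) x a"
  have inj: "inj_on x (carrier R)"
    using x(2) by (auto simp: Bij_def bij_betw_def)
  have "inv_into (carrier R) x \<one> = \<one>"
    using inv_into_f_f[OF inj one_closed] ring_hom_one[OF x(1)] by simp
  then have "?y \<in> ring_hom R R"
    using x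
    by (intro ring_hom_memI)
       (auto simp: Bij_inv_into_mem ring_hom_mult ring_hom_add intro!: Bij_inv_into_lemma)
  with x(2) show "inv\<^bsub>BijGroup (carrier R)\<^esub> x \<in> ring_auto R"
    by (simp add: inv_BijGroup ring_auto_def restrict_inv_into_Bij del: restrict_apply)
qed

lemma (in ring) group_RingAutoGroup: "group (RingAutoGroup R)"
  by (simp add: RingAutoGroup_def subgroup.subgroup_is_group subgroup_ring_auto group_BijGroup)

end

theory Submission
  imports Defs
begin

text \<open>
  Write \<open>R\<^sup>G\<close> and \<open>S\<^sup>G\<close> for the fixed rings, and let \<open>R\<^sup>G \<subseteq> T \<subseteq> S\<^sup>G\<close>. The hypothesis speaks about rings
  above \<open>R\<close>, so \<open>T\<close> is enlarged to the compositum \<open>A\<close> of \<open>R\<close> and \<open>T\<close> inside \<open>S\<close>. Two facts about the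
  finite group action connect the extension \<open>R\<^sup>G \<subseteq> T\<close> with the extension \<open>R \<subseteq> A\<close>.

  First, \<open>R\<close> is integral over \<open>R\<^sup>G\<close>: an element is a root of the product of the \<open>x - \<sigma> r\<close>, whose
  coefficients are invariant (\<open>integral_over_fixed_ring\<close>). Integral elements form a subring
  (\<open>subring_integral_closure\<close>), so \<open>A\<close> is integral over \<open>T\<close>, and primes of \<open>T\<close> lift to \<open>A\<close>
  (\<open>lying_over\<close>).

  Second, \<open>R\<^sup>G \<subseteq> R\<close> satisfies Going-Down (\<open>going_down_fixed_ring\<close>). This is a norm argument: any prime
  over \<open>p\<^sub>1\<close> can be moved by the group below a given prime over \<open>p\<^sub>2 \<supseteq> p\<^sub>1\<close>.

  Now let \<open>q\<^sub>2\<close> be a prime of \<open>T\<close> over \<open>p\<^sub>2\<close>, and \<open>p\<^sub>1 \<subseteq> p\<^sub>2\<close>. Lift \<open>q\<^sub>2\<close> to a prime \<open>Q\<^sub>2\<close> of \<open>A\<close>. Its trace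
  \<open>Q\<^sub>2 \<inter> R\<close> lies over \<open>p\<^sub>2\<close>, so it contains a prime \<open>P\<^sub>1\<close> of \<open>R\<close> over \<open>p\<^sub>1\<close>. Going-Down for \<open>R \<subseteq> A\<close> gives a
  prime \<open>Q\<^sub>1 \<subseteq> Q\<^sub>2\<close> over \<open>P\<^sub>1\<close>, and \<open>Q\<^sub>1 \<inter> T\<close> is the required prime of \<open>T\<close>.
\<close>

section \<open>Prime ideals\<close>

text \<open>Krull's lemma. Primality is the usual consequence of maximality among the ideals that avoid
  \<open>M\<close>; the maximality itself is part of the conclusion, because lying over needs it once more to
  turn an element outside \<open>P\<close> into an element of \<open>M\<close>.\<close>

lemma (in cring) exists_maximal_avoiding_prime:
  assumes "M \<subseteq> carrier R" "\<one> \<in> M" "\<zero> \<notin> M"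
    and M_mult: "\<And>x y. \<lbrakk>x \<in> M; y \<in> M\<rbrakk> \<Longrightarrow> x \<otimes> y \<in> M"
  obtains P where "primeideal P R" "P \<inter> M = {}"
    and "\<And>x. \<lbrakk>x \<in> carrier R; x \<notin> P\<rbrakk> \<Longrightarrow> \<exists>w\<in>P. \<exists>a\<in>carrier R. w \<oplus> a \<otimes> x \<in> M"
proof -
  define \<I> where "\<I> = {I. ideal I R \<and> I \<inter> M = {}}"
  have "\<exists>P\<in>\<I>. \<forall>J\<in>\<I>. P \<subseteq> J \<longrightarrow> J = P"
  proof (rule subset_Zorn_nonempty)
    have "{\<zero>} \<in> \<I>"
      unfolding \<I>_def using zeroideal assms(3) by auto
    then show "\<I> \<noteq> {}" by blast
  next
    fix C assume "C \<noteq> {}" and C: "subset.chain \<I> C"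
    then have "subset.chain {I. ideal I R} C"
      by (auto simp: \<I>_def subset.chain_def)
    from chain_Union_is_ideal[OF this] \<open>C \<noteq> {}\<close> have "ideal (\<Union>C) R" by simp
    moreover have "\<Union>C \<inter> M = {}"
      using C by (auto simp: \<I>_def subset.chain_def)
    ultimately show "\<Union>C \<in> \<I>" by (simp add: \<I>_def)
  qed
  then obtain P where "P \<in> \<I>" and P_max: "\<forall>J\<in>\<I>. P \<subseteq> J \<longrightarrow> J = P" ..
  then have P: "ideal P R" "P \<inter> M = {}" by (simp_all add: \<I>_def)
  have max: "J = P" if "ideal J R" "J \<inter> M = {}" "P \<subseteq> J" for J
    using P_max that by (simp add: \<I>_def)
  interpret P: ideal P R by fact
  have meets: "\<exists>w\<in>P. \<exists>a\<in>carrier R. w \<oplus> a \<otimes> x \<in> M" if x: "x \<in> carrier R" "x \<notin> P" for x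
  proof -
    have "ideal (P <+>\<^bsub>R\<^esub> PIdl x) R"
      by (intro add_ideals P cgenideal_ideal x)
    moreover have in_sum: "w \<oplus> j \<in> P <+>\<^bsub>R\<^esub> PIdl x" if "w \<in> P" "j \<in> PIdl x" for w j
      unfolding set_add_def' using that by (intro UN_I[of w] UN_I[of j]) simp_all
    have "P \<subseteq> P <+>\<^bsub>R\<^esub> PIdl x"
    proof
      fix p assume p: "p \<in> P"
      have "\<zero> \<in> PIdl x"
        using additive_subgroup.zero_closed[OF ideal.axioms(1)[OF cgenideal_ideal[OF x(1)]]] .
      from in_sum[OF p this] show "p \<in> P <+>\<^bsub>R\<^esub> PIdl x"
        using P.Icarr[OF p] by simp
    qed
    moreover have "x \<in> P <+>\<^bsub>R\<^esub> PIdl x"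
      using in_sum[OF P.zero_closed cgenideal_self[OF x(1)]] x(1) by simp
    ultimately have "(P <+>\<^bsub>R\<^esub> PIdl x) \<inter> M \<noteq> {}"
      using max x(2) by metis
    then obtain y where y: "y \<in> P <+>\<^bsub>R\<^esub> PIdl x" "y \<in> M" by (meson disjoint_iff)
    obtain w j where wj: "w \<in> P" "j \<in> PIdl x" "y = w \<oplus> j"
      using y(1) unfolding set_add_def' by (elim UN_E) simp
    obtain a where "a \<in> carrier R" "j = a \<otimes> x"
      using wj(2) unfolding cgenideal_def by (elim CollectE exE conjE)
    then show ?thesis
      using wj y(2) by metis
  qed
  have "primeideal P R"
  proof (rule primeidealI[OF P(1) is_cring])
    show "carrier R \<noteq> P"
      using assms(2) P(2) by auto
  next
    fix x y assume xy: "x \<in> carrier R" "y \<in> carrier R" "x \<otimes> y \<in> P"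
    show "x \<in> P \<or> y \<in> P"
    proof (rule ccontr)
      assume "\<not> (x \<in> P \<or> y \<in> P)"
      then have notin: "x \<notin> P" "y \<notin> P" by simp_all
      obtain v a where v: "v \<in> P" "a \<in> carrier R" "v \<oplus> a \<otimes> x \<in> M"
        using meets[OF xy(1) notin(1)] by (elim bexE)
      obtain w b where w: "w \<in> P" "b \<in> carrier R" "w \<oplus> b \<otimes> y \<in> M"
        using meets[OF xy(2) notin(2)] by (elim bexE)
      have c: "v \<in> carrier R" "w \<in> carrier R"
        using v w P.Icarr by auto
      have "(v \<oplus> a \<otimes> x) \<otimes> (w \<oplus> b \<otimes> y) =
            v \<otimes> (w \<oplus> b \<otimes> y) \<oplus> ((a \<otimes> x) \<otimes> w \<oplus> (a \<otimes> b) \<otimes> (x \<otimes> y))"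
        using c v(2) w(2) xy by algebra
      also have "\<dots> \<in> P"
        using v w xy c by (intro P.a_closed P.I_r_closed[of v] P.I_l_closed[of w] P.I_l_closed[of "x \<otimes> y"]) auto
      finally show False
        using M_mult[OF v(3) w(3)] P(2) by (simp add: disjoint_iff)
    qed
  qed
  then show thesis
    using that P(2) meets by metis
qed

text \<open>Prime avoidance, in the contrapositive form: if no \<open>P \<in> F\<close> contains \<open>I\<close>, then some element of
  \<open>I\<close> lies outside all of them. Induction on \<open>F\<close>: let \<open>x \<in> I\<close> avoid \<open>F\<close> but lie in the new prime \<open>P\<close>.
  It is corrected by some \<open>z \<in> I\<close> that lies outside \<open>P\<close> but in every \<open>P' \<in> F\<close> not contained in \<open>P\<close>. Then
  \<open>x \<oplus> z\<close> is outside \<open>P\<close>, hence outside the \<open>P'\<close> contained in \<open>P\<close>, and it is outside the other \<open>P'\<close>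
  because \<open>x\<close> is.\<close>

lemma (in cring) prime_avoidance:
  assumes "finite F" "\<And>P. P \<in> F \<Longrightarrow> primeideal P R" "ideal I R" "I \<subseteq> \<Union>F"
  shows "\<exists>P\<in>F. I \<subseteq> P"
proof (rule ccontr)
  assume "\<not> (\<exists>P\<in>F. I \<subseteq> P)"
  interpret I: ideal I R by fact
  have "\<lbrakk>\<forall>P\<in>F. primeideal P R \<and> \<not> I \<subseteq> P\<rbrakk> \<Longrightarrow> \<exists>x\<in>I. x \<notin> \<Union>F"
    using \<open>finite F\<close>
  proof (induction F)
    case empty
    then show ?case using I.zero_closed by blast
  next
    case (insert P F)
    then obtain x where x: "x \<in> I" "x \<notin> \<Union>F" by auto
    interpret P: primeideal P R using insert.prems by blast
    show ?case
    proof (cases "x \<in> P")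
      case True
      obtain y where y: "y \<in> I" "y \<notin> P" using insert.prems by blast
      \<comment> \<open>Multiply \<open>y\<close> by one element of \<open>P' - P\<close> for each \<open>P'\<close> not contained in \<open>P\<close>.\<close>
      have "\<exists>z\<in>I. z \<notin> P \<and> (\<forall>P'\<in>F. \<not> P' \<subseteq> P \<longrightarrow> z \<in> P')"
        using \<open>finite F\<close> insert.prems
      proof (induction F)
        case empty
        then show ?case using y by auto
      next
        case (insert P' F)
        then obtain z where z: "z \<in> I" "z \<notin> P" "\<forall>P'\<in>F. \<not> P' \<subseteq> P \<longrightarrow> z \<in> P'"
          by auto
        interpret P': primeideal P' R using insert.prems by blast
        show ?case
        proof (cases "P' \<subseteq> P")
          case True
          then show ?thesis using z by blast
        next
          case False
          then obtain c where c: "c \<in> P'" "c \<notin> P" by blast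
          have cz: "c \<in> carrier R" "z \<in> carrier R"
            using c z P'.Icarr I.Icarr by auto
          have "c \<otimes> z \<in> I" "c \<otimes> z \<in> P'"
            using c(1) z(1) cz by (simp_all add: I.I_l_closed P'.I_r_closed)
          moreover have "c \<otimes> z \<notin> P"
            using P.I_prime[OF cz] c(2) z(2) by blast
          moreover have "c \<otimes> z \<in> P''" if "P'' \<in> F" "\<not> P'' \<subseteq> P" for P''
            using z(3) that cz(1) insert.prems
            by (meson ideal.I_l_closed insertCI primeideal.axioms(1))
          ultimately show ?thesis by blast
        qed
      qed
      then obtain z where z: "z \<in> I" "z \<notin> P" "\<And>P'. \<lbrakk>P'\<in>F; \<not> P' \<subseteq> P\<rbrakk> \<Longrightarrow> z \<in> P'" by blast
      have xz: "x \<in> carrier R" "z \<in> carrier R" "x \<oplus> z \<in> I"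
        using x z I.Icarr by auto
      have sub: "b \<in> J" if "ideal J R" "a \<oplus> b \<in> J" "a \<in> J" "b \<in> carrier R" for J a b
      proof -
        interpret J: ideal J R by fact
        have "b = \<ominus> a \<oplus> (a \<oplus> b)"
          using that J.Icarr by (simp add: r_neg1)
        then show ?thesis
          using that J.a_closed J.a_inv_closed by metis
      qed
      have "x \<oplus> z \<notin> P"
        using sub[OF P.is_ideal _ True] z(2) xz by blast
      moreover have "x \<oplus> z \<notin> P'" if "P' \<in> F" for P'
      proof (cases "P' \<subseteq> P")
        case False
        then have "z \<in> P'" using z(3) that by blast
        moreover have "ideal P' R" using insert.prems that by (simp add: primeideal.axioms(1))
        ultimately show ?thesis
          using sub[of P' z x] xz x(2) that by (auto simp: a_comm)
      qed (use calculation in blast)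
      ultimately show ?thesis using xz by blast
    qed (use x in blast)
  qed
  then show False
    using assms \<open>\<not> (\<exists>P\<in>F. I \<subseteq> P)\<close> by blast
qed

lemma (in cring) primeideal_multiplicative:
  assumes "primeideal P R"
  shows "\<one> \<notin> P" "\<And>x y. \<lbrakk>x \<in> carrier R - P; y \<in> carrier R - P\<rbrakk> \<Longrightarrow> x \<otimes> y \<in> carrier R - P"
  using assms ideal.one_imp_carrier[of P R] primeideal.I_prime[OF assms] primeideal.I_notcarr[OF assms]
  by (auto dest: primeideal.axioms(1))

lemma (in ring_hom_cring) primeideal_vimage:
  assumes "primeideal P S"
  shows "primeideal {r \<in> carrier R. h r \<in> P} R"
proof (rule primeidealI)
  interpret P: primeideal P S by fact
  show "ideal {r \<in> carrier R. h r \<in> P} R"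
    using ring.ideal_vimage[OF P.is_ideal] .
  show "cring R" by (rule R.is_cring)
  show "carrier R \<noteq> {r \<in> carrier R. h r \<in> P}"
  proof
    assume "carrier R = {r \<in> carrier R. h r \<in> P}"
    with R.one_closed have "h \<one> \<in> P" by blast
    then show False
      using S.primeideal_multiplicative(1)[OF assms] by simp
  qed
  show "a \<in> {r \<in> carrier R. h r \<in> P} \<or> b \<in> {r \<in> carrier R. h r \<in> P}"
    if "a \<in> carrier R" "b \<in> carrier R" "a \<otimes> b \<in> {r \<in> carrier R. h r \<in> P}" for a b
    using that P.I_prime[of "h a" "h b"] by auto
qed

lemma (in cring) primeideal_contract:
  assumes "subring A R" "primeideal P R"
  shows "primeideal (P \<inter> A) (R\<lparr>carrier := A\<rparr>)"
proof -
  have A: "A \<subseteq> carrier R" using subringE(1)[OF assms(1)] .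
  have cA: "cring (R\<lparr>carrier := A\<rparr>)"
    using subcring_iff[OF A] subcringI'[OF assms(1)] by simp
  interpret incl: ring_hom_cring "R\<lparr>carrier := A\<rparr>" R "\<lambda>a. a"
    using cA A by (intro ring_hom_cring.intro is_cring)
      (auto simp: ring_hom_cring_axioms_def intro!: ring_hom_memI)
  show ?thesis
    using incl.primeideal_vimage[OF assms(2)] by (simp add: Int_def conj_commute)
qed

section \<open>Integral elements\<close>

text \<open>The closure properties below are stated for coefficient sets \<open>B\<close> of a commutative ring with
  just the closure that each of them needs, because \<open>B\<close> will be either a subring or a prime
  ideal of a subring.\<close>

context cring
begin

lemma Span_Cons_iff: "v \<in> Span K (e # es) \<longleftrightarrow> (\<exists>k\<in>K. \<exists>u\<in>Span K es. v = k \<otimes> e \<oplus> u)"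
  by (simp add: line_extension_mem_iff)

lemma Span_least:
  assumes "\<zero> \<in> N" "\<And>x y. \<lbrakk>x \<in> N; y \<in> N\<rbrakk> \<Longrightarrow> x \<oplus> y \<in> N"
    and "\<And>b e. \<lbrakk>b \<in> B; e \<in> set es\<rbrakk> \<Longrightarrow> b \<otimes> e \<in> N"
  shows "Span B es \<subseteq> N"
  using assms(3)
proof (induction es)
  case (Cons e es)
  then have "Span B es \<subseteq> N" by simp
  with Cons.prems assms(2) show ?case by (auto simp: line_extension_mem_iff subset_iff)
qed (use assms(1) in simp)

lemma Span_add:
  assumes "set es \<subseteq> carrier R" "B \<subseteq> carrier R"
    and B_add: "\<And>x y. \<lbrakk>x \<in> B; y \<in> B\<rbrakk> \<Longrightarrow> x \<oplus> y \<in> B"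
    and "u \<in> Span B es" "v \<in> Span B es"
  shows "u \<oplus> v \<in> Span B es"
  using assms(1,4,5)
proof (induction es arbitrary: u v)
  case (Cons e es)
  obtain j u' k v' where u: "j \<in> B" "u' \<in> Span B es" "u = j \<otimes> e \<oplus> u'"
    and v: "k \<in> B" "v' \<in> Span B es" "v = k \<otimes> e \<oplus> v'"
    using Cons.prems(2,3) unfolding Span_Cons_iff by blast
  have "u' \<in> carrier R" "v' \<in> carrier R"
    using u(2) v(2) Span_in_carrier[OF assms(2), of es] Cons.prems(1) by auto
  then have "u \<oplus> v = (j \<oplus> k) \<otimes> e \<oplus> (u' \<oplus> v')"
    using u v assms(2) Cons.prems(1) by (simp add: subset_iff) algebra
  moreover have "u' \<oplus> v' \<in> Span B es"
    using Cons u v by simp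
  ultimately show ?case
    using B_add u(1) v(1) unfolding Span_Cons_iff by blast
qed simp

lemma Span_mult:
  assumes "set es \<subseteq> carrier R" "B \<subseteq> carrier R" "b \<in> carrier R"
    and B_mult: "\<And>x. \<lbrakk>x \<in> B\<rbrakk> \<Longrightarrow> b \<otimes> x \<in> B"
    and "u \<in> Span B es"
  shows "b \<otimes> u \<in> Span B es"
  using assms(1,5)
proof (induction es arbitrary: u)
  case (Cons e es)
  obtain j u' where u: "j \<in> B" "u' \<in> Span B es" "u = j \<otimes> e \<oplus> u'"
    using Cons.prems(2) unfolding Span_Cons_iff by blast
  have "u' \<in> carrier R"
    using u(2) Span_in_carrier[OF assms(2), of es] Cons.prems(1) by auto
  then have "b \<otimes> u = (b \<otimes> j) \<otimes> e \<oplus> b \<otimes> u'"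
    using u assms(2,3) Cons.prems(1) by (simp add: subset_iff) algebra
  moreover have "b \<otimes> u' \<in> Span B es"
    using Cons u by simp
  ultimately show ?case
    using B_mult u(1) unfolding Span_Cons_iff by blast
qed (use assms(3) in simp)

lemma Span_zero:
  assumes "set es \<subseteq> carrier R" "\<zero> \<in> B"
  shows "\<zero> \<in> Span B es"
  using assms
proof (induction es)
  case (Cons e es)
  then have "\<zero> = \<zero> \<otimes> e \<oplus> \<zero>" "\<zero> \<in> Span B es" by auto
  then show ?case
    using assms(2) unfolding Span_Cons_iff by blast
qed simp

lemma Span_smult_gen:
  assumes "set es \<subseteq> carrier R" "B \<subseteq> carrier R" "\<zero> \<in> B" "b \<in> B" "e \<in> set es"
  shows "b \<otimes> e \<in> Span B es"
  using assms(1,5)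
proof (induction es)
  case (Cons f es)
  have b: "b \<in> carrier R" using assms by auto
  show ?case
  proof (cases "e = f")
    case True
    have "b \<otimes> e = b \<otimes> f \<oplus> \<zero>" using True b Cons.prems by auto
    moreover have "\<zero> \<in> Span B es" using Span_zero assms(3) Cons.prems(1) by auto
    ultimately show ?thesis
      using assms(4) unfolding Span_Cons_iff by blast
  next
    case False
    then have "b \<otimes> e \<in> Span B es" "b \<otimes> e = \<zero> \<otimes> f \<oplus> b \<otimes> e"
      using Cons b by auto
    then show ?thesis
      using assms(3) unfolding Span_Cons_iff by blast
  qed
qed simp

end

text \<open>Integrality is phrased through a faithful finitely generated \<open>B\<close>-submodule that is stable under
  multiplication by \<open>a\<close>; the submodule contains \<open>\<one>\<close>, which makes it faithful. For subrings \<open>B\<close> this is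
  equivalent to the existence of a monic equation over \<open>B\<close>, and it is the form that passes directly
  to sums and products and that lying over consumes.\<close>

definition (in ring) integral_over :: "'a set \<Rightarrow> 'a \<Rightarrow> bool"
  where "integral_over B a \<longleftrightarrow> a \<in> carrier R \<and>
    (\<exists>es. set es \<subseteq> carrier R \<and> \<one> \<in> set es \<and> (\<forall>e\<in>set es. a \<otimes> e \<in> Span B es))"

context cring
begin

text \<open>The two rings \<open>A\<close> and \<open>A'\<close> in which the witnessing generators live are recorded in the carrier;
  the spans themselves do not depend on them.\<close>

lemma integral_over_mono:
  assumes "subring A R" "subring A' R" "A \<subseteq> A'" "B \<subseteq> B'"
    and "ring.integral_over (R\<lparr>carrier := A\<rparr>) B a"
  shows "ring.integral_over (R\<lparr>carrier := A'\<rparr>) B' a"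
proof -
  have mono: "Span B es \<subseteq> Span B' es" for es
    by (induction es) (use \<open>B \<subseteq> B'\<close> in \<open>auto simp: line_extension_mem_iff\<close>, blast)
  show ?thesis
    using assms(3,5) mono
    unfolding ring.integral_over_def[OF subring_is_ring[OF assms(1)]]
      ring.integral_over_def[OF subring_is_ring[OF assms(2)]]
      Span_consistent[OF assms(1)] Span_consistent[OF assms(2)]
    by simp (meson subset_iff)
qed

lemma Span_stable:
  assumes "set es \<subseteq> carrier R" "subring B R" "a \<in> carrier R"
    and "\<And>e. e \<in> set es \<Longrightarrow> a \<otimes> e \<in> Span B es" "v \<in> Span B es"
  shows "a \<otimes> v \<in> Span B es"
proof -
  note B = subringE[OF assms(2)]
  have "Span B es \<subseteq> {v \<in> carrier R. a \<otimes> v \<in> Span B es}"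
  proof (rule Span_least)
    show "\<zero> \<in> {v \<in> carrier R. a \<otimes> v \<in> Span B es}"
      using assms(3) Span_zero[OF assms(1) B(2)] by simp
  next
    fix x y assume "x \<in> {v \<in> carrier R. a \<otimes> v \<in> Span B es}" "y \<in> {v \<in> carrier R. a \<otimes> v \<in> Span B es}"
    then show "x \<oplus> y \<in> {v \<in> carrier R. a \<otimes> v \<in> Span B es}"
      using Span_add[OF assms(1) B(1,7)] assms(3) by (simp add: r_distr)
  next
    fix b e assume be: "b \<in> B" "e \<in> set es"
    then have c: "b \<in> carrier R" "e \<in> carrier R" using B(1) assms(1) by auto
    have "b \<otimes> (a \<otimes> e) \<in> Span B es"
      using Span_mult[OF assms(1) B(1) c(1) B(6)[OF be(1)]] assms(4) be by blast
    then show "b \<otimes> e \<in> {v \<in> carrier R. a \<otimes> v \<in> Span B es}"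
      using c assms(3) by (simp add: m_lcomm)
  qed
  then show ?thesis using assms(5) by blast
qed

lemma integral_over_base:
  assumes "subring B R" "b \<in> B"
  shows "integral_over B b"
proof -
  note B = subringE[OF assms(1)]
  have "b \<otimes> \<one> \<in> Span B [\<one>]"
    using Span_smult_gen[of "[\<one>]" B b \<one>] B assms(2) by simp
  then show ?thesis
    unfolding integral_over_def using assms(2) B(1) by (intro conjI exI[of _ "[\<one>]"]) auto
qed

text \<open>If \<open>es\<close> and \<open>fs\<close> generate submodules that witness the integrality of \<open>a\<close> and of \<open>b\<close>, then the
  products \<open>e \<otimes> f\<close> generate one that is stable under both \<open>a\<close> and \<open>b\<close>, hence under
  \<open>a \<oplus> b\<close> and \<open>a \<otimes> b\<close>.\<close>

lemma subring_integral_closure: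
  assumes "subring B R"
  shows "subring {a. integral_over B a} R"
proof -
  note B = subringE[OF assms]
  note base = integral_over_base[OF assms]
  have joint: "\<exists>gs. set gs \<subseteq> carrier R \<and> \<one> \<in> set gs \<and>
      (\<forall>g\<in>set gs. a \<otimes> g \<in> Span B gs \<and> b \<otimes> g \<in> Span B gs)"
    if ab: "integral_over B a" "integral_over B b" for a b
  proof -
    obtain es fs where es: "set es \<subseteq> carrier R" "\<one> \<in> set es" "\<And>e. e \<in> set es \<Longrightarrow> a \<otimes> e \<in> Span B es"
      and fs: "set fs \<subseteq> carrier R" "\<one> \<in> set fs" "\<And>e. e \<in> set fs \<Longrightarrow> b \<otimes> e \<in> Span B fs"
      and c: "a \<in> carrier R" "b \<in> carrier R"
      using ab unfolding integral_over_def by blast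
    define gs where "gs = [e \<otimes> f. e \<leftarrow> es, f \<leftarrow> fs]"
    have set_gs: "set gs = {e \<otimes> f |e f. e \<in> set es \<and> f \<in> set fs}"
      unfolding gs_def by auto
    have gs: "set gs \<subseteq> carrier R"
      using es(1) fs(1) unfolding set_gs by auto
    have one: "\<one> \<in> set gs"
      unfolding set_gs using es(2) fs(2) by force
    have N: "Span B us \<subseteq> {v \<in> carrier R. v \<otimes> w \<in> Span B gs}"
      if us: "set us \<subseteq> carrier R" and w: "w \<in> carrier R"
        and uw: "\<And>u. u \<in> set us \<Longrightarrow> u \<otimes> w \<in> set gs" for us w
    proof (rule Span_least)
      show "\<zero> \<in> {v \<in> carrier R. v \<otimes> w \<in> Span B gs}"
        using w Span_zero[OF gs B(2)] by simp
    next
      fix x y assume "x \<in> {v \<in> carrier R. v \<otimes> w \<in> Span B gs}" "y \<in> {v \<in> carrier R. v \<otimes> w \<in> Span B gs}"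
      then show "x \<oplus> y \<in> {v \<in> carrier R. v \<otimes> w \<in> Span B gs}"
        using Span_add[OF gs B(1,7)] w by (simp add: l_distr)
    next
      fix k u assume ku: "k \<in> B" "u \<in> set us"
      then have "k \<otimes> (u \<otimes> w) \<in> Span B gs"
        using Span_smult_gen[OF gs B(1,2)] uw by blast
      then show "k \<otimes> u \<in> {v \<in> carrier R. v \<otimes> w \<in> Span B gs}"
        using ku B(1) us w by (auto simp: m_assoc subset_iff)
    qed
    have "a \<otimes> g \<in> Span B gs \<and> b \<otimes> g \<in> Span B gs" if g: "g \<in> set gs" for g
    proof -
      obtain e f where ef: "e \<in> set es" "f \<in> set fs" "g = e \<otimes> f" using g set_gs by blast
      then have efc: "e \<in> carrier R" "f \<in> carrier R" using es(1) fs(1) by auto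
      have "(a \<otimes> e) \<otimes> f \<in> Span B gs"
        using N[OF es(1) efc(2)] es(3)[OF ef(1)] ef(2) set_gs by blast
      moreover have "(b \<otimes> f) \<otimes> e \<in> Span B gs"
      proof -
        have "u \<otimes> e \<in> set gs" if "u \<in> set fs" for u
          using that ef(1) efc(1) fs(1) m_comm[of u e] unfolding set_gs by blast
        then show ?thesis
          using N[OF fs(1) efc(1)] fs(3)[OF ef(2)] by blast
      qed
      moreover have "(b \<otimes> f) \<otimes> e = b \<otimes> g" "(a \<otimes> e) \<otimes> f = a \<otimes> g"
        using c efc ef(3) by (simp_all add: m_ac)
      ultimately show ?thesis by simp
    qed
    then show ?thesis using gs one by blast
  qed
  have mult: "integral_over B (a \<otimes> b)" if ab: "integral_over B a" "integral_over B b" for a b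
  proof -
    obtain gs where gs: "set gs \<subseteq> carrier R" "\<one> \<in> set gs"
      "\<And>g. g \<in> set gs \<Longrightarrow> a \<otimes> g \<in> Span B gs" "\<And>g. g \<in> set gs \<Longrightarrow> b \<otimes> g \<in> Span B gs"
      using joint[OF ab] by blast
    have c: "a \<in> carrier R" "b \<in> carrier R"
      using ab by (auto simp: integral_over_def)
    have "a \<otimes> (b \<otimes> g) \<in> Span B gs" if "g \<in> set gs" for g
      using Span_stable[OF gs(1) assms c(1) gs(3)] gs(4) that by blast
    then have "\<forall>g\<in>set gs. a \<otimes> b \<otimes> g \<in> Span B gs"
      using c gs(1) by (auto simp: m_assoc subset_iff)
    then show ?thesis
      using gs(1,2) c unfolding integral_over_def by blast
  qed
  have add: "integral_over B (a \<oplus> b)" if ab: "integral_over B a" "integral_over B b" for a b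
  proof -
    obtain gs where gs: "set gs \<subseteq> carrier R" "\<one> \<in> set gs"
      "\<And>g. g \<in> set gs \<Longrightarrow> a \<otimes> g \<in> Span B gs" "\<And>g. g \<in> set gs \<Longrightarrow> b \<otimes> g \<in> Span B gs"
      using joint[OF ab] by blast
    have c: "a \<in> carrier R" "b \<in> carrier R"
      using ab by (auto simp: integral_over_def)
    have "\<forall>g\<in>set gs. (a \<oplus> b) \<otimes> g \<in> Span B gs"
      using Span_add[OF gs(1) B(1,7) gs(3,4)] c gs(1) by (auto simp: l_distr subset_iff)
    then show ?thesis
      using gs(1,2) c unfolding integral_over_def by blast
  qed
  show ?thesis
  proof (rule subringI)
    fix h assume h: "h \<in> {a. integral_over B a}"
    have "integral_over B (\<ominus> \<one> \<otimes> h)"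
      using mult[OF base[OF B(5)[OF B(3)]]] h by simp
    then show "\<ominus> h \<in> {a. integral_over B a}"
      using h by (simp add: integral_over_def l_minus)
  qed (use base B mult add in \<open>auto simp: integral_over_def\<close>)
qed

end

section \<open>Lying over\<close>

context cring
begin

text \<open>Nakayama's lemma for the module generated by \<open>es\<close>, modulo \<open>Q\<close> and localized at \<open>q\<close>: if an \<open>x\<close>
  outside \<open>q\<close>, which acts as a unit, maps the generators into \<open>q\<close>-combinations of themselves, then the
  module vanishes locally, that is, some \<open>s\<close> outside \<open>q\<close> kills it. Induction on the generators:
  if \<open>c0\<close> is the coefficient of the generator \<open>f\<close> in \<open>x \<otimes> f\<close>, then \<open>y = x \<ominus> c0\<close> is still outside \<open>q\<close>, and
  \<open>y \<otimes> f\<close> is a combination of the remaining generators. So, after multiplication by \<open>y\<close>, the generator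
  \<open>f\<close> can be eliminated from all the relations.\<close>

lemma nakayama_mod:
  assumes B: "subring B R" and q: "primeideal q (R\<lparr>carrier := B\<rparr>)" and Q: "ideal Q R"
    and "set es \<subseteq> carrier R" "x \<in> B" "x \<notin> q"
    and "\<And>e. e \<in> set es \<Longrightarrow> \<exists>w\<in>Q. \<exists>v\<in>Span q es. x \<otimes> e = w \<oplus> v"
  shows "\<exists>s\<in>B - q. \<forall>e\<in>set es. s \<otimes> e \<in> Q"
  using assms(4-7)
proof (induction es arbitrary: x)
  case Nil
  then show ?case by auto
next
  case (Cons f es)
  interpret Q: ideal Q R by fact
  interpret q: primeideal q "R\<lparr>carrier := B\<rparr>" by fact
  note BE = subringE[OF B]
  have qB: "q \<subseteq> B" using q.a_subset by simp
  then have qR: "q \<subseteq> carrier R" using BE(1) by simp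
  have q_mult: "b \<otimes> c \<in> q" if "b \<in> B" "c \<in> q" for b c
    using q.I_l_closed[of c b] that by simp
  have q_add: "b \<oplus> c \<in> q" if "b \<in> q" "c \<in> q" for b c
    using additive_subgroup.a_closed[OF ideal.axioms(1)[OF q.is_ideal], of b c] that by simp
  have mult_notin: "b \<otimes> c \<in> B - q" if "b \<in> B - q" "c \<in> B - q" for b c
    using q.I_prime[of b c] that BE(6) by auto
  have esc: "set es \<subseteq> carrier R" "f \<in> carrier R" using Cons.prems by auto
  have Sc: "Span q es \<subseteq> carrier R" using Span_in_carrier[OF qR esc(1)] .
  have xc: "x \<in> carrier R" using Cons.prems BE(1) by auto
  have decompose: "\<exists>w\<in>Q. \<exists>c\<in>q. \<exists>v\<in>Span q es. x \<otimes> e = w \<oplus> (c \<otimes> f \<oplus> v)"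
    if e: "e \<in> set (f # es)" for e
  proof -
    obtain w u where w: "w \<in> Q" "u \<in> Span q (f # es)" "x \<otimes> e = w \<oplus> u"
      using Cons.prems(4)[OF e] by (elim bexE)
    obtain c v where "c \<in> q" "v \<in> Span q es" "u = c \<otimes> f \<oplus> v"
      using iffD1[OF Span_Cons_iff w(2)] by (elim bexE)
    then show ?thesis using w by metis
  qed
  obtain w0 c0 v0 where f: "w0 \<in> Q" "c0 \<in> q" "v0 \<in> Span q es" "x \<otimes> f = w0 \<oplus> (c0 \<otimes> f \<oplus> v0)"
    using decompose[OF list.set_intros(1)] by (elim bexE)
  have fc: "w0 \<in> carrier R" "c0 \<in> carrier R" "v0 \<in> carrier R"
    using f Q.Icarr qR Sc by auto
  define y where "y = x \<ominus> c0"
  have yB: "y \<in> B" unfolding y_def a_minus_def using Cons.prems(2) f(2) qB BE(5,7) by blast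
  have yc: "y \<in> carrier R" using yB BE(1) by auto
  have "y \<notin> q"
  proof
    assume "y \<in> q"
    then have "y \<oplus> c0 \<in> q" using q_add f by blast
    moreover have "y \<oplus> c0 = x" unfolding y_def using xc fc by algebra
    ultimately show False using Cons.prems by simp
  qed
  have yf: "y \<otimes> f = w0 \<oplus> v0"
  proof -
    have "y \<otimes> f = x \<otimes> f \<ominus> c0 \<otimes> f" unfolding y_def using xc fc esc by algebra
    also have "\<dots> = w0 \<oplus> v0" unfolding f(4) using fc esc by algebra
    finally show ?thesis .
  qed
  have yx: "y \<otimes> x \<in> B - q"
    using mult_notin yB \<open>y \<notin> q\<close> Cons.prems by blast
  have "\<exists>w\<in>Q. \<exists>v\<in>Span q es. y \<otimes> x \<otimes> e = w \<oplus> v" if e: "e \<in> set es" for e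
  proof -
    obtain w c v where ex: "w \<in> Q" "c \<in> q" "v \<in> Span q es" "x \<otimes> e = w \<oplus> (c \<otimes> f \<oplus> v)"
      using decompose[OF list.set_intros(2)[OF e]] by (elim bexE)
    have ec: "w \<in> carrier R" "c \<in> carrier R" "v \<in> carrier R" "e \<in> carrier R"
      using ex Q.Icarr qR Sc e esc by auto
    have "y \<otimes> x \<otimes> e = y \<otimes> (x \<otimes> e)" using yc xc ec by (simp add: m_assoc)
    also have "\<dots> = y \<otimes> w \<oplus> (c \<otimes> (y \<otimes> f) \<oplus> y \<otimes> v)" unfolding ex(4) using ec yc esc by algebra
    also have "\<dots> = (y \<otimes> w \<oplus> c \<otimes> w0) \<oplus> (c \<otimes> v0 \<oplus> y \<otimes> v)" unfolding yf using ec yc fc by algebra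
    finally have "y \<otimes> x \<otimes> e = (y \<otimes> w \<oplus> c \<otimes> w0) \<oplus> (c \<otimes> v0 \<oplus> y \<otimes> v)" .
    moreover have "y \<otimes> w \<oplus> c \<otimes> w0 \<in> Q"
      using Q.a_closed Q.I_l_closed ex f yc ec by simp
    moreover have "c \<otimes> v0 \<oplus> y \<otimes> v \<in> Span q es"
      using Span_add[OF esc(1) qR q_add] Span_mult[OF esc(1) qR ec(2) _ f(3)]
        Span_mult[OF esc(1) qR yc _ ex(3)] q_mult yB qB ex(2) by blast
    ultimately show ?thesis by metis
  qed
  then obtain s where s: "s \<in> B - q" "\<forall>e\<in>set es. s \<otimes> e \<in> Q"
    using Cons.IH[OF esc(1), of "y \<otimes> x"] yx by blast
  have sc: "s \<in> carrier R" using s BE(1) by auto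
  have "Span q es \<subseteq> {v \<in> carrier R. s \<otimes> v \<in> Q}"
  proof (rule Span_least)
    fix b e assume be: "b \<in> q" "e \<in> set es"
    then have c: "b \<in> carrier R" "e \<in> carrier R" using qR esc by auto
    then have "b \<otimes> (s \<otimes> e) \<in> Q" using s be Q.I_l_closed by blast
    then show "b \<otimes> e \<in> {v \<in> carrier R. s \<otimes> v \<in> Q}" using c sc by (simp add: m_lcomm)
  qed (use sc in \<open>auto simp: r_distr\<close>)
  then have "s \<otimes> (w0 \<oplus> v0) \<in> Q"
    using f sc fc by (auto simp: r_distr Q.I_l_closed)
  then have "s \<otimes> y \<otimes> f \<in> Q" using yf sc yc esc by (simp add: m_assoc)
  moreover have "s \<otimes> y \<otimes> e \<in> Q" if "e \<in> set es" for e
  proof -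
    have "y \<otimes> (s \<otimes> e) \<in> Q" using s that yc Q.I_l_closed by blast
    moreover have "e \<in> carrier R" using that esc by auto
    ultimately show ?thesis using yc sc by (simp add: m_assoc m_lcomm)
  qed
  ultimately show ?case
    using mult_notin[OF s(1)] yB \<open>y \<notin> q\<close> by auto
qed

text \<open>Take \<open>Q\<close> maximal among the ideals disjoint from \<open>B - q\<close>, so that \<open>Q \<inter> B \<subseteq> q\<close>. If some \<open>t \<in> q\<close> were
  outside \<open>Q\<close>, then maximality gives \<open>w \<in> Q\<close> and \<open>a\<close> with \<open>w \<oplus> a \<otimes> t \<in> B - q\<close>. On a module that witnesses the
  integrality of \<open>a\<close>, this element acts modulo \<open>Q\<close> as \<open>t \<otimes> a\<close>, hence with coefficients in \<open>q\<close>. By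
  Nakayama's lemma some \<open>s \<in> B - q\<close> maps the module into \<open>Q\<close>; as \<open>\<one>\<close> is in it, \<open>s \<in> Q\<close>, a contradiction.\<close>

lemma lying_over:
  assumes B: "subring B R" and integral: "\<And>a. a \<in> carrier R \<Longrightarrow> integral_over B a"
    and q: "primeideal q (R\<lparr>carrier := B\<rparr>)"
  obtains Q where "primeideal Q R" "Q \<inter> B = q"
proof -
  interpret q: primeideal q "R\<lparr>carrier := B\<rparr>" by fact
  note BE = subringE[OF B]
  have cB: "cring (R\<lparr>carrier := B\<rparr>)" by (rule q.is_cring)
  have qB: "q \<subseteq> B" using q.a_subset by simp
  then have qR: "q \<subseteq> carrier R" using BE(1) by simp
  have q_zero: "\<zero> \<in> q"
    using additive_subgroup.zero_closed[OF ideal.axioms(1)[OF q.is_ideal]] by simp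
  have q_add: "x \<oplus> y \<in> q" if "x \<in> q" "y \<in> q" for x y
    using additive_subgroup.a_closed[OF ideal.axioms(1)[OF q.is_ideal], of x y] that by simp_all
  have M: "B - q \<subseteq> carrier R" "\<one> \<in> B - q" "\<zero> \<notin> B - q"
    using BE cring.primeideal_multiplicative(1)[OF cB q] q_zero by auto
  have Mm: "x \<otimes> y \<in> B - q" if "x \<in> B - q" "y \<in> B - q" for x y
    using cring.primeideal_multiplicative(2)[OF cB q, of x y] that by simp
  obtain Q where Q: "primeideal Q R" "Q \<inter> (B - q) = {}"
    and max: "\<And>x. \<lbrakk>x \<in> carrier R; x \<notin> Q\<rbrakk> \<Longrightarrow> \<exists>w\<in>Q. \<exists>a\<in>carrier R. w \<oplus> a \<otimes> x \<in> B - q"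
    using exists_maximal_avoiding_prime[OF M Mm] by blast
  interpret Q: primeideal Q R by fact
  have "t \<in> Q" if t: "t \<in> q" for t
  proof (rule ccontr)
    assume "t \<notin> Q"
    have tc: "t \<in> carrier R" using t qR by auto
    obtain w a where wa: "w \<in> Q" "a \<in> carrier R" "w \<oplus> a \<otimes> t \<in> B - q"
      using max[OF tc \<open>t \<notin> Q\<close>] by blast
    obtain es where es: "set es \<subseteq> carrier R" "\<one> \<in> set es" "\<And>e. e \<in> set es \<Longrightarrow> a \<otimes> e \<in> Span B es"
      using integral[OF wa(2)] unfolding integral_over_def by blast
    have tS: "Span B es \<subseteq> {v \<in> carrier R. t \<otimes> v \<in> Span q es}"
    proof (rule Span_least)
      show "\<zero> \<in> {v \<in> carrier R. t \<otimes> v \<in> Span q es}"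
        using tc Span_zero[OF es(1), of q] q_zero by simp
    next
      fix x y assume "x \<in> {v \<in> carrier R. t \<otimes> v \<in> Span q es}" "y \<in> {v \<in> carrier R. t \<otimes> v \<in> Span q es}"
      then show "x \<oplus> y \<in> {v \<in> carrier R. t \<otimes> v \<in> Span q es}"
        using Span_add[OF es(1) qR] q_add tc by (simp add: r_distr)
    next
      fix b e assume be: "b \<in> B" "e \<in> set es"
      then have c: "b \<in> carrier R" "e \<in> carrier R" using BE(1) es by auto
      have "(t \<otimes> b) \<otimes> e \<in> Span q es"
        using Span_smult_gen[OF es(1) qR] q_zero q.I_r_closed[OF t] be by simp
      then show "b \<otimes> e \<in> {v \<in> carrier R. t \<otimes> v \<in> Span q es}"
        using c tc by (simp add: m_assoc)
    qed
    have "\<exists>u\<in>Q. \<exists>v\<in>Span q es. (w \<oplus> a \<otimes> t) \<otimes> e = u \<oplus> v" if e: "e \<in> set es" for e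
    proof -
      have c: "e \<in> carrier R" "w \<in> carrier R" using e es wa Q.Icarr by auto
      have "(w \<oplus> a \<otimes> t) \<otimes> e = w \<otimes> e \<oplus> t \<otimes> (a \<otimes> e)"
        using c tc wa(2) by algebra
      moreover have "w \<otimes> e \<in> Q" using wa(1) c Q.I_r_closed by blast
      moreover have "t \<otimes> (a \<otimes> e) \<in> Span q es" using es(3)[OF e] tS by blast
      ultimately show ?thesis by blast
    qed
    from nakayama_mod[OF B q Q.is_ideal es(1) _ _ this] wa(3)
    obtain s where "s \<in> B - q" "s \<otimes> \<one> \<in> Q" using es(2) by blast
    moreover have "s \<in> carrier R" using \<open>s \<in> B - q\<close> M(1) by (rule rev_subsetD)
    ultimately show False using Q(2) \<open>s \<in> B - q\<close> by auto
  qed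
  then have "Q \<inter> B = q" using Q(2) qB by blast
  then show thesis using that Q(1) by blast
qed

end

section \<open>Monic polynomials with prescribed roots\<close>

context ring
begin

text \<open>Polynomials are given by their coefficient functions. The function \<open>mult_linear a\<close> is
  multiplication by \<open>x - a\<close>, so \<open>root_poly as\<close> is the product of the \<open>x - a\<close> for \<open>a\<close> in \<open>as\<close>.\<close>

definition mult_linear :: "'a \<Rightarrow> (nat \<Rightarrow> 'a) \<Rightarrow> nat \<Rightarrow> 'a"
  where "mult_linear a p k = (case k of 0 \<Rightarrow> \<zero> | Suc j \<Rightarrow> p j) \<ominus> a \<otimes> p k"

definition root_poly :: "'a list \<Rightarrow> nat \<Rightarrow> 'a"
  where "root_poly as = foldr mult_linear as (\<lambda>k. if k = 0 then \<one> else \<zero>)"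

end

context cring
begin

lemma root_poly_Nil: "root_poly [] = (\<lambda>k. if k = 0 then \<one> else \<zero>)"
  and root_poly_Cons: "root_poly (a # as) = mult_linear a (root_poly as)"
  by (simp_all add: root_poly_def)

lemma mult_linear_closed:
  "\<lbrakk>a \<in> carrier R; \<And>k. p k \<in> carrier R\<rbrakk> \<Longrightarrow> mult_linear a p k \<in> carrier R"
  by (simp add: mult_linear_def split: nat.split)

lemma root_poly_closed: "set as \<subseteq> carrier R \<Longrightarrow> root_poly as k \<in> carrier R"
  by (induction as arbitrary: k) (simp_all add: root_poly_Nil root_poly_Cons mult_linear_closed)

lemma root_poly_beyond: "\<lbrakk>set as \<subseteq> carrier R; length as < k\<rbrakk> \<Longrightarrow> root_poly as k = \<zero>"
proof (induction as arbitrary: k)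
  case (Cons a as)
  then obtain j where "k = Suc j" "length as < j" by (cases k) auto
  with Cons show ?case
    by (simp add: root_poly_Cons mult_linear_def a_minus_def)
qed (simp add: root_poly_Nil)

lemma root_poly_monic: "set as \<subseteq> carrier R \<Longrightarrow> root_poly as (length as) = \<one>"
  by (induction as)
    (simp_all add: root_poly_Nil root_poly_Cons mult_linear_def root_poly_beyond a_minus_def)

lemma mult_linear_commute:
  assumes "a \<in> carrier R" "b \<in> carrier R" "\<And>k. p k \<in> carrier R"
  shows "mult_linear a (mult_linear b p) = mult_linear b (mult_linear a p)"
proof
  fix k
  consider "k = 0" | "k = Suc 0" | j where "k = Suc (Suc j)"
    by (metis not0_implies_Suc)
  then show "mult_linear a (mult_linear b p) k = mult_linear b (mult_linear a p) k"
  proof cases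
    case 1
    then show ?thesis
      unfolding mult_linear_def using assms(1,2) assms(3)[of 0] by simp algebra
  next
    case 2
    then show ?thesis
      unfolding mult_linear_def using assms(1,2) assms(3)[of 0] assms(3)[of 1] by simp algebra
  next
    case (3 j)
    then show ?thesis
      unfolding mult_linear_def using assms(1,2) assms(3)[of j] assms(3)[of "Suc j"] assms(3)[of "Suc (Suc j)"]
      by simp algebra
  qed
qed

text \<open>The coefficients are symmetric functions of the roots. Together with the next lemma this
  places the coefficients in the fixed ring as soon as the group permutes the roots.\<close>

lemma root_poly_permute:
  assumes "mset as = mset bs" "set as \<subseteq> carrier R"
  shows "root_poly as = root_poly bs"
  unfolding root_poly_def foldr_conv_fold
proof (rule fold_permuted_eq[where P = "\<lambda>p. \<forall>k. p k \<in> carrier R"])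
  show "mset (rev as) = mset (rev bs)" using assms by simp
next
  fix x and p :: "nat \<Rightarrow> 'a" assume "x \<in> set (rev as)" "\<forall>k. p k \<in> carrier R"
  then show "\<forall>k. mult_linear x p k \<in> carrier R"
    using assms(2) mult_linear_closed by auto
next
  fix x y and p :: "nat \<Rightarrow> 'a" assume "x \<in> set (rev as)" "y \<in> set (rev as)" "\<forall>k. p k \<in> carrier R"
  then show "mult_linear x (mult_linear y p) = mult_linear y (mult_linear x p)"
    using assms(2) by (intro mult_linear_commute) auto
qed simp

lemma root_poly_hom:
  assumes "h \<in> ring_hom R R" "set as \<subseteq> carrier R"
  shows "h (root_poly as k) = root_poly (map h as) k"
  using assms(2)
proof (induction as arbitrary: k)
  case Nil
  then show ?case
    using ring_hom_one[OF assms(1)] ring_hom_zero[OF assms(1) ring_axioms ring_axioms]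
    by (simp add: root_poly_Nil)
next
  case (Cons a as)
  interpret h: ring_hom_cring R R h
    using assms(1) by unfold_locales
  show ?case
    using Cons by (simp add: root_poly_Cons mult_linear_def a_minus_def root_poly_closed split: nat.split)
qed

lemma root_poly_eval:
  assumes "x \<in> carrier R" "set as \<subseteq> carrier R"
  shows "(\<Oplus>k\<in>{..length as}. root_poly as k \<otimes> x [^] k) = foldr (\<lambda>a v. (x \<ominus> a) \<otimes> v) as \<one>"
  using assms(2)
proof (induction as)
  case Nil
  then show ?case by (simp add: root_poly_Nil)
next
  case (Cons a as)
  let ?n = "length as" and ?p = "root_poly as"
  have c: "a \<in> carrier R" "set as \<subseteq> carrier R" and p: "\<And>k. ?p k \<in> carrier R"
    using Cons.prems root_poly_closed by auto
  let ?s = "\<lambda>k. case k of 0 \<Rightarrow> \<zero> | Suc j \<Rightarrow> ?p j"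
  have s: "?s k \<in> carrier R" for k using p by (simp split: nat.split)
  let ?E = "\<Oplus>k\<in>{..?n}. ?p k \<otimes> x [^] k"
  have E: "?E \<in> carrier R" using p assms(1) by simp
  have "(\<Oplus>k\<in>{..Suc ?n}. ?s k \<otimes> x [^] k) = (\<Oplus>k\<in>{..?n}. ?p k \<otimes> x [^] Suc k)"
    using s p assms(1) by (subst finsum_Suc2) (auto simp: Pi_def)
  also have "\<dots> = (\<Oplus>k\<in>{..?n}. x \<otimes> (?p k \<otimes> x [^] k))"
    using p assms(1) by (intro finsum_cong') (auto simp: m_ac)
  also have "\<dots> = x \<otimes> ?E"
    using p assms(1) by (subst finsum_rdistr) auto
  finally have 1: "(\<Oplus>k\<in>{..Suc ?n}. ?s k \<otimes> x [^] k) = x \<otimes> ?E" .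
  have "(\<Oplus>k\<in>{..Suc ?n}. (\<ominus> a) \<otimes> (?p k \<otimes> x [^] k)) = (\<ominus> a) \<otimes> (\<Oplus>k\<in>{..Suc ?n}. ?p k \<otimes> x [^] k)"
    using p c assms(1) by (subst finsum_rdistr) auto
  also have "\<dots> = (\<ominus> a) \<otimes> ?E"
    using p c assms(1) root_poly_beyond[OF c(2), of "Suc ?n"] by (simp add: Pi_def)
  finally have 2: "(\<Oplus>k\<in>{..Suc ?n}. (\<ominus> a) \<otimes> (?p k \<otimes> x [^] k)) = (\<ominus> a) \<otimes> ?E" .
  have "(\<Oplus>k\<in>{..Suc ?n}. root_poly (a # as) k \<otimes> x [^] k)
      = (\<Oplus>k\<in>{..Suc ?n}. ?s k \<otimes> x [^] k \<oplus> (\<ominus> a) \<otimes> (?p k \<otimes> x [^] k))"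
  proof (rule finsum_cong')
    fix k :: nat
    have distrib: "(s \<ominus> a \<otimes> c) \<otimes> y = s \<otimes> y \<oplus> (\<ominus> a) \<otimes> (c \<otimes> y)"
      if "s \<in> carrier R" "c \<in> carrier R" "y \<in> carrier R" for s c y
      using that c(1) by algebra
    show "root_poly (a # as) k \<otimes> x [^] k = ?s k \<otimes> x [^] k \<oplus> (\<ominus> a) \<otimes> (?p k \<otimes> x [^] k)"
      unfolding root_poly_Cons mult_linear_def
      using distrib[OF s p nat_pow_closed[OF assms(1)]] .
  qed (use s p c(1) assms(1) in auto)
  also have "\<dots> = x \<otimes> ?E \<oplus> (\<ominus> a) \<otimes> ?E"
    unfolding 1[symmetric] 2[symmetric]
    by (rule finsum_addf) (use s p c assms(1) in auto)
  also have "\<dots> = (x \<ominus> a) \<otimes> ?E"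
    using E c(1) assms(1) by (simp add: a_minus_def l_distr)
  finally show ?case
    using Cons.IH[OF c(2)] by simp
qed

lemma foldr_linear_root:
  assumes "x \<in> set as" "set as \<subseteq> carrier R"
  shows "foldr (\<lambda>a v. (x \<ominus> a) \<otimes> v) as \<one> = \<zero>"
proof -
  have xc: "x \<in> carrier R" using assms by auto
  have cl: "foldr (\<lambda>a v. (x \<ominus> a) \<otimes> v) bs \<one> \<in> carrier R" if "set bs \<subseteq> carrier R" for bs
    using that xc by (induction bs) auto
  show ?thesis
    using assms
  proof (induction as)
    case (Cons a as)
    then show ?case
      using cl[of as] xc by (cases "x = a") (auto simp: a_minus_def r_neg)
  qed simp
qed

text \<open>The powers of the root \<open>x\<close> below the degree generate a stable module, since the monic equation
  expresses the first missing power through them.\<close>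

lemma integral_over_root:
  assumes B: "subring B R" and as: "set as \<subseteq> carrier R" and x: "x \<in> set as"
    and coeff: "\<And>k. root_poly as k \<in> B"
  shows "integral_over B x"
proof -
  note BE = subringE[OF B]
  have xc: "x \<in> carrier R" using as x by auto
  define n where "n = length as"
  have "n > 0" using x unfolding n_def by (cases as) auto
  define es where "es = map (\<lambda>k. x [^] k) [0..<n]"
  have es: "set es \<subseteq> carrier R" unfolding es_def using xc by auto
  have pow: "x [^] k \<in> set es" if "k < n" for k
    unfolding es_def using that by auto
  have fin: "(\<Oplus>k\<in>A. c k \<otimes> x [^] k) \<in> Span B es"
    if "finite A" "A \<subseteq> {..<n}" "\<And>k. c k \<in> B" for A and c :: "nat \<Rightarrow> 'a"
    using that(1,2)
  proof (induction A)
    case empty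
    then show ?case using Span_zero[OF es BE(2)] by simp
  next
    case (insert k A)
    have "(\<Oplus>k\<in>insert k A. c k \<otimes> x [^] k) = c k \<otimes> x [^] k \<oplus> (\<Oplus>k\<in>A. c k \<otimes> x [^] k)"
      using insert that(3) BE(1) xc by (subst finsum_insert) (auto simp: Pi_def)
    moreover have "c k \<otimes> x [^] k \<in> Span B es"
      using Span_smult_gen[OF es BE(1,2) that(3) pow] insert.prems by auto
    ultimately show ?case
      using Span_add[OF es BE(1,7)] insert by simp
  qed
  have c: "root_poly as k \<in> carrier R" for k using coeff BE(1) by auto
  have "(\<Oplus>k\<in>{..n}. root_poly as k \<otimes> x [^] k) = \<zero>"
    unfolding n_def root_poly_eval[OF xc as] using foldr_linear_root[OF x as] .
  moreover have "(\<Oplus>k\<in>{..n}. root_poly as k \<otimes> x [^] k)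
      = root_poly as n \<otimes> x [^] n \<oplus> (\<Oplus>k\<in>{..<n}. root_poly as k \<otimes> x [^] k)"
    using c xc by (intro add.finprod_Suc3) auto
  moreover have "root_poly as n \<otimes> x [^] n = x [^] n"
    unfolding n_def root_poly_monic[OF as] using xc by simp
  ultimately have "x [^] n = \<ominus> (\<Oplus>k\<in>{..<n}. root_poly as k \<otimes> x [^] k)"
    using xc c by (simp add: minus_equality[symmetric])
  also have "\<dots> = \<ominus> \<one> \<otimes> (\<Oplus>k\<in>{..<n}. root_poly as k \<otimes> x [^] k)"
    using xc c by (simp add: l_minus)
  also have "\<dots> \<in> Span B es"
    using Span_mult[OF es BE(1) _ BE(6)[OF BE(5)[OF BE(3)]] fin[OF _ _ coeff]] by simp
  finally have top: "x [^] n \<in> Span B es" .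
  have "x \<otimes> e \<in> Span B es" if e_in: "e \<in> set es" for e
  proof -
    obtain k :: nat where k: "k < n" "e = x [^] k" using e_in unfolding es_def by auto
    have e: "x \<otimes> e = x [^] Suc k" using k xc by (simp add: m_comm)
    show ?thesis
    proof (cases "Suc k = n")
      case True
      then show ?thesis using e top by simp
    next
      case False
      then have "\<one> \<otimes> x [^] Suc k \<in> Span B es"
        using k by (intro Span_smult_gen[OF es BE(1,2,3)] pow) simp
      then show ?thesis using e xc by simp
    qed
  qed
  moreover have "\<one> \<in> set es" using pow[OF \<open>n > 0\<close>] by simp
  ultimately show ?thesis
    unfolding integral_over_def using xc es by blast
qed

text \<open>Up to sign, the constant coefficient is the product of the roots. When the roots are the
  conjugates of an element, it plays the part of the norm.\<close>

lemma root_poly_0_in_ideal: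
  assumes "ideal I R" "set as \<subseteq> carrier R" "x \<in> set as" "x \<in> I"
  shows "root_poly as 0 \<in> I"
  using assms(2,3)
proof (induction as)
  case (Cons a as)
  interpret I: ideal I R by fact
  have e: "root_poly (a # as) 0 = \<ominus> (a \<otimes> root_poly as 0)"
    using Cons.prems root_poly_closed[of as 0] by (simp add: root_poly_Cons mult_linear_def a_minus_def)
  have "a \<otimes> root_poly as 0 \<in> I"
    using Cons assms(4) root_poly_closed[of as 0] I.I_l_closed I.I_r_closed by (cases "x = a") auto
  then show ?case using e by simp
qed simp

lemma root_poly_0_in_prime:
  assumes "primeideal P R" "set as \<subseteq> carrier R" "root_poly as 0 \<in> P"
  shows "\<exists>x\<in>set as. x \<in> P"
  using assms(2,3)
proof (induction as)
  case Nil
  then show ?case using primeideal_multiplicative(1)[OF assms(1)] by (simp add: root_poly_Nil)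
next
  case (Cons a as)
  interpret P: primeideal P R by fact
  have c: "a \<in> carrier R" "root_poly as 0 \<in> carrier R" using Cons.prems root_poly_closed[of as 0] by auto
  have "a \<otimes> root_poly as 0 = \<ominus> (root_poly (a # as) 0)"
    using c by (simp add: root_poly_Cons mult_linear_def a_minus_def)
  then have "a \<otimes> root_poly as 0 \<in> P" using Cons.prems(2) by simp
  then show ?case using P.I_prime[OF c] Cons by auto
qed

end

section \<open>Finite groups acting on a ring\<close>

text \<open>The group acts through a homomorphism \<open>\<phi>\<close> instead of being a set of automorphisms, because
  distinct automorphisms of a ring may have the same restriction to a stable subring.\<close>

locale finite_ring_action = cring R + group_action \<Gamma> "carrier R" \<phi>
  for R (structure) and \<Gamma> and \<phi> +
  assumes finite_group: "finite (carrier \<Gamma>)"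
    and action_hom: "g \<in> carrier \<Gamma> \<Longrightarrow> \<phi> g \<in> ring_hom R R"
begin

definition fixed_ring :: "'a set"
  where "fixed_ring = {a \<in> carrier R. \<forall>g\<in>carrier \<Gamma>. \<phi> g a = a}"

lemma action_closed: "\<lbrakk>g \<in> carrier \<Gamma>; a \<in> carrier R\<rbrakk> \<Longrightarrow> \<phi> g a \<in> carrier R"
  using ring_hom_closed[OF action_hom] .

lemma subring_fixed_ring: "subring fixed_ring R"
proof (rule subringI)
  fix h assume h: "h \<in> fixed_ring"
  have "\<phi> g (\<ominus> h) = \<ominus> \<phi> g h" if "g \<in> carrier \<Gamma>" for g
  proof -
    interpret h: ring_hom_cring R R "\<phi> g"
      using action_hom[OF that] by unfold_locales
    show ?thesis using h by (simp add: fixed_ring_def)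
  qed
  then show "\<ominus> h \<in> fixed_ring" using h by (simp add: fixed_ring_def)
qed (auto simp: fixed_ring_def ring_hom_mult[OF action_hom] ring_hom_add[OF action_hom] ring_hom_one[OF action_hom])

text \<open>The list has one entry for each group element, so conjugates may be repeated. Left translation
  permutes the group elements, so the action of the group permutes the list.\<close>

lemma ex_conjugates:
  assumes a: "a \<in> carrier R"
  obtains as where "set as = (\<lambda>g. \<phi> g a) ` carrier \<Gamma>" "set as \<subseteq> carrier R" "a \<in> set as"
    "\<And>k. root_poly as k \<in> fixed_ring"
proof -
  interpret \<Gamma>: Group.group \<Gamma>
    using group_hom group_hom.axioms(1) by blast
  obtain gs where gs: "set gs = carrier \<Gamma>" "distinct gs"
    using finite_distinct_list[OF finite_group] by blast
  define as where "as = map (\<lambda>g. \<phi> g a) gs"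
  have set_as: "set as = (\<lambda>g. \<phi> g a) ` carrier \<Gamma>"
    unfolding as_def using gs by simp
  have carr: "set as \<subseteq> carrier R"
    unfolding set_as using action_closed a by auto
  have "\<phi> \<one>\<^bsub>\<Gamma>\<^esub> a = a"
    using id_eq_one a by (metis restrict_apply')
  then have "a \<in> set as"
    unfolding set_as by (metis image_eqI \<Gamma>.one_closed)
  moreover have "root_poly as k \<in> fixed_ring" for k
  proof -
    have "\<phi> h (root_poly as k) = root_poly as k" if h: "h \<in> carrier \<Gamma>" for h
    proof -
      have "map (\<phi> h) as = map (\<lambda>g. \<phi> g a) (map (\<lambda>g. h \<otimes>\<^bsub>\<Gamma>\<^esub> g) gs)"
        unfolding as_def using composition_rule[OF a h] gs(1) by simp
      moreover have "mset (map (\<lambda>g. h \<otimes>\<^bsub>\<Gamma>\<^esub> g) gs) = mset gs"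
      proof (rule set_eq_iff_mset_eq_distinct[THEN iffD1])
        show "distinct (map (\<lambda>g. h \<otimes>\<^bsub>\<Gamma>\<^esub> g) gs)"
          using gs \<Gamma>.inj_on_multc h by (simp add: distinct_map inj_on_def)
        show "set (map (\<lambda>g. h \<otimes>\<^bsub>\<Gamma>\<^esub> g) gs) = set gs"
          using gs(1) \<Gamma>.surj_const_mult[OF h] by simp
      qed (rule gs(2))
      ultimately have "mset (map (\<phi> h) as) = mset as"
        unfolding as_def by (metis mset_map)
      then have "root_poly (map (\<phi> h) as) = root_poly as"
        using root_poly_permute[of as "map (\<phi> h) as"] carr by simp
      then show ?thesis
        using root_poly_hom[OF action_hom[OF h] carr] by simp
    qed
    then show ?thesis
      using root_poly_closed[OF carr] by (simp add: fixed_ring_def)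
  qed
  ultimately show thesis using that set_as carr by blast
qed

lemma integral_over_fixed_ring: "a \<in> carrier R \<Longrightarrow> integral_over fixed_ring a"
  using ex_conjugates integral_over_root[OF subring_fixed_ring] by metis

lemma primeideal_action_vimage:
  assumes "primeideal P R" "g \<in> carrier \<Gamma>"
  shows "primeideal {a \<in> carrier R. \<phi> g a \<in> P} R"
proof -
  interpret h: ring_hom_cring R R "\<phi> g"
    using action_hom[OF assms(2)] by unfold_locales
  show ?thesis
    using h.primeideal_vimage[OF assms(1)] .
qed

text \<open>Let \<open>P\<close> be a prime over \<open>p1\<close>. The norm of an \<open>a \<in> P\<close> lies in \<open>P \<inter> fixed_ring = p1 \<subseteq> p2 \<subseteq> Q2\<close>, so some
  conjugate of \<open>a\<close> lies in the prime \<open>Q2\<close>. Thus \<open>P\<close> is covered by the finitely many preimages of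
  \<open>Q2\<close> under the group; by prime avoidance one of them contains \<open>P\<close>, and the corresponding
  translate of \<open>P\<close> is a prime below \<open>Q2\<close> with the same trace \<open>p1\<close> on the fixed ring.\<close>

lemma going_down_fixed_ring: "going_down fixed_ring R"
  unfolding going_down_def
proof (intro allI impI, elim conjE)
  fix p1 p2 Q2
  let ?F = "R\<lparr>carrier := fixed_ring\<rparr>"
  assume p: "primeideal p1 ?F" "primeideal p2 ?F" "p1 \<subseteq> p2" and Q2: "primeideal Q2 R" "Q2 \<inter> fixed_ring = p2"
  obtain P where P: "primeideal P R" "P \<inter> fixed_ring = p1"
    using lying_over[OF subring_fixed_ring integral_over_fixed_ring p(1)] by blast
  interpret P: primeideal P R by fact
  let ?pre = "\<lambda>g. {a \<in> carrier R. \<phi> g a \<in> Q2}"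
  have "P \<subseteq> \<Union>(?pre ` carrier \<Gamma>)"
  proof
    fix a assume a: "a \<in> P"
    then have ac: "a \<in> carrier R" by (rule P.Icarr)
    obtain as where as: "set as = (\<lambda>g. \<phi> g a) ` carrier \<Gamma>" "set as \<subseteq> carrier R" "a \<in> set as"
      "\<And>k. root_poly as k \<in> fixed_ring"
      using ex_conjugates[OF ac] by metis
    have "root_poly as 0 \<in> P \<inter> fixed_ring"
      using root_poly_0_in_ideal[OF P.is_ideal as(2,3) a] as(4) by simp
    then have "root_poly as 0 \<in> Q2"
      using P(2) p(3) Q2(2) by auto
    then obtain x where "x \<in> set as" "x \<in> Q2"
      using root_poly_0_in_prime[OF Q2(1) as(2)] by metis
    then show "a \<in> \<Union>(?pre ` carrier \<Gamma>)"
      using as(1) ac by auto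
  qed
  then have "\<exists>J\<in>?pre ` carrier \<Gamma>. P \<subseteq> J"
    using finite_group primeideal_action_vimage[OF Q2(1)] by (intro prime_avoidance P.is_ideal) auto
  then obtain g where g: "g \<in> carrier \<Gamma>" "P \<subseteq> ?pre g" by (elim bexE imageE) simp
  interpret \<Gamma>: Group.group \<Gamma>
    using group_hom group_hom.axioms(1) by blast
  let ?h = "inv\<^bsub>\<Gamma>\<^esub> g"
  have h: "?h \<in> carrier \<Gamma>" using g(1) by simp
  let ?Q1 = "{a \<in> carrier R. \<phi> ?h a \<in> P}"
  have "primeideal ?Q1 R" using primeideal_action_vimage[OF P(1) h] .
  moreover have "?Q1 \<subseteq> Q2"
  proof
    fix a assume a: "a \<in> ?Q1"
    then have "\<phi> g (\<phi> ?h a) \<in> Q2" using g(2) by auto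
    moreover have "\<phi> g (\<phi> ?h a) = a"
      using orbit_sym_aux[OF h, of a] a g(1) by simp
    ultimately show "a \<in> Q2" by simp
  qed
  moreover have "?Q1 \<inter> fixed_ring = p1"
    using P(2) h by (auto simp: fixed_ring_def)
  ultimately show "\<exists>q1. primeideal q1 R \<and> q1 \<subseteq> Q2 \<and> q1 \<inter> fixed_ring = p1"
    by metis
qed

end

lemma restrict_Bij_of_right_inverse:
  assumes "\<sigma> \<in> Bij E" "A \<subseteq> E" "\<sigma> ` A \<subseteq> A" "\<tau> ` A \<subseteq> A" "\<And>a. a \<in> A \<Longrightarrow> \<sigma> (\<tau> a) = a"
  shows "restrict \<sigma> A \<in> Bij A"
proof -
  have "inj_on \<sigma> A"
    using assms(1,2) by (auto simp: Bij_def bij_betw_def intro: inj_on_subset)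
  moreover have "A \<subseteq> \<sigma> ` A"
    using assms(4,5) by (metis image_eqI image_subset_iff subsetI)
  ultimately show ?thesis
    using assms(3) by (auto simp: Bij_def bij_betw_def inj_on_def)
qed

text \<open>Automorphisms are extensional functions on the big ring, so they have to be restricted to act on
  \<open>A\<close>. Stability is an inclusion only; that \<open>\<sigma>\<close> maps onto \<open>A\<close> comes from the stability under its
  inverse.\<close>

lemma (in cring) automorphisms_act_on_stable_subring:
  assumes G: "subgroup G (RingAutoGroup R)" "finite G"
    and A: "subring A R" and stable: "\<And>\<sigma>. \<sigma> \<in> G \<Longrightarrow> \<sigma> ` A \<subseteq> A"
  shows "finite_ring_action (R\<lparr>carrier := A\<rparr>) (RingAutoGroup R\<lparr>carrier := G\<rparr>) (\<lambda>\<sigma>. restrict \<sigma> A)"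
proof -
  interpret U: Group.group "RingAutoGroup R" by (rule group_RingAutoGroup)
  note AE = subringE[OF A]
  have G_auto: "\<sigma> \<in> ring_hom R R" "\<sigma> \<in> Bij (carrier R)" if "\<sigma> \<in> G" for \<sigma>
    using subgroup.subset[OF G(1)] that by (auto simp: RingAutoGroup_def ring_auto_def)
  have mult: "\<sigma> \<otimes>\<^bsub>RingAutoGroup R\<^esub> \<tau> = compose (carrier R) \<sigma> \<tau>" if "\<sigma> \<in> G" "\<tau> \<in> G" for \<sigma> \<tau>
    using G_auto that by (simp add: RingAutoGroup_def BijGroup_def)
  have one: "\<one>\<^bsub>RingAutoGroup R\<^esub> = (\<lambda>x\<in>carrier R. x)"
    by (simp add: RingAutoGroup_def BijGroup_def)
  have bij: "restrict \<sigma> A \<in> Bij A" if \<sigma>: "\<sigma> \<in> G" for \<sigma>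
  proof -
    let ?\<tau> = "inv\<^bsub>RingAutoGroup R\<^esub> \<sigma>"
    have \<tau>: "?\<tau> \<in> G" using subgroup.m_inv_closed[OF G(1) \<sigma>] .
    have "\<sigma> \<otimes>\<^bsub>RingAutoGroup R\<^esub> ?\<tau> = \<one>\<^bsub>RingAutoGroup R\<^esub>"
      using U.r_inv subgroup.mem_carrier[OF G(1) \<sigma>] by blast
    then have "compose (carrier R) \<sigma> ?\<tau> = (\<lambda>x\<in>carrier R. x)"
      unfolding mult[OF \<sigma> \<tau>] one .
    then have "\<sigma> (?\<tau> a) = a" if "a \<in> A" for a
      using AE(1) that by (metis compose_eq restrict_apply' subsetD)
    then show ?thesis
      by (rule restrict_Bij_of_right_inverse[OF G_auto(2)[OF \<sigma>] AE(1) stable[OF \<sigma>] stable[OF \<tau>]])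
  qed
  have "(\<lambda>\<sigma>. restrict \<sigma> A) \<in> hom (RingAutoGroup R\<lparr>carrier := G\<rparr>) (BijGroup A)"
  proof (rule homI)
    fix \<sigma> assume "\<sigma> \<in> carrier (RingAutoGroup R\<lparr>carrier := G\<rparr>)"
    then show "restrict \<sigma> A \<in> carrier (BijGroup A)"
      using bij by (simp add: BijGroup_def)
  next
    fix \<sigma> \<tau> assume "\<sigma> \<in> carrier (RingAutoGroup R\<lparr>carrier := G\<rparr>)" "\<tau> \<in> carrier (RingAutoGroup R\<lparr>carrier := G\<rparr>)"
    then have st: "\<sigma> \<in> G" "\<tau> \<in> G" by simp_all
    have "restrict (compose (carrier R) \<sigma> \<tau>) A = compose A (restrict \<sigma> A) (restrict \<tau> A)"
      using stable[OF st(2)] AE(1) by (auto simp: compose_def fun_eq_iff subset_iff image_subset_iff)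
    then show "restrict (\<sigma> \<otimes>\<^bsub>RingAutoGroup R\<lparr>carrier := G\<rparr>\<^esub> \<tau>) A = restrict \<sigma> A \<otimes>\<^bsub>BijGroup A\<^esub> restrict \<tau> A"
      using mult[OF st] bij st by (simp add: BijGroup_def)
  qed
  moreover have "Group.group (RingAutoGroup R\<lparr>carrier := G\<rparr>)"
    using subgroup.subgroup_is_group[OF G(1) group_RingAutoGroup] .
  ultimately have "group_action (RingAutoGroup R\<lparr>carrier := G\<rparr>) A (\<lambda>\<sigma>. restrict \<sigma> A)"
    by (simp add: group_action_def group_hom_def group_hom_axioms_def group_BijGroup)
  moreover have "restrict \<sigma> A \<in> ring_hom (R\<lparr>carrier := A\<rparr>) (R\<lparr>carrier := A\<rparr>)" if \<sigma>: "\<sigma> \<in> G" for \<sigma>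
    using stable[OF \<sigma>] AE
    by (intro ring_hom_memI)
      (auto simp: subset_iff ring_hom_mult[OF G_auto(1)[OF \<sigma>]] ring_hom_add[OF G_auto(1)[OF \<sigma>]] ring_hom_one[OF G_auto(1)[OF \<sigma>]])
  moreover have "cring (R\<lparr>carrier := A\<rparr>)"
    using subcring_iff[OF AE(1)] subcringI'[OF A] by simp
  ultimately show ?thesis
    using G(2) by (simp add: finite_ring_action_def finite_ring_action_axioms_def)
qed

section \<open>Going-down pairs of fixed rings\<close>

lemma going_down_prime:
  assumes "going_down A T" "primeideal q2 T" "primeideal (q2 \<inter> A) (T\<lparr>carrier := A\<rparr>)"
    and "primeideal p1 (T\<lparr>carrier := A\<rparr>)" "p1 \<subseteq> q2 \<inter> A"
  obtains q1 where "primeideal q1 T" "q1 \<subseteq> q2" "q1 \<inter> A = p1"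
  using assms unfolding going_down_def by metis

theorem theorem3p2:
  fixes S :: "('a, 'b) ring_scheme" and R :: "'a set" and G :: "('a \<Rightarrow> 'a) set"
  assumes "domain S"
    and "subdomain R S"
    and "subgroup G (RingAutoGroup S)"
    and "finite G"
    and "\<And>\<sigma>. \<sigma> \<in> G \<Longrightarrow> \<sigma> ` R \<subseteq> R"
    and "GD_pair R S"
  shows "GD_pair (fixed_points G R) (S\<lparr>carrier := fixed_points G (carrier S)\<rparr>)"
proof -
  interpret S: domain S by fact
  have R: "subring R S"
    using assms(2) by (meson subcring.axioms(1) subdomain.axioms(1))
  note RE = subringE[OF R]
  have stable_S: "\<sigma> ` carrier S \<subseteq> carrier S" if "\<sigma> \<in> G" for \<sigma>
    using subgroup.subset[OF assms(3)] that
    by (auto simp: RingAutoGroup_def ring_auto_def dest: ring_hom_closed)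
  interpret onR: finite_ring_action "S\<lparr>carrier := R\<rparr>" "RingAutoGroup S\<lparr>carrier := G\<rparr>" "\<lambda>\<sigma>. restrict \<sigma> R"
    using S.automorphisms_act_on_stable_subring[OF assms(3,4) R assms(5)] .
  interpret onS: finite_ring_action "S" "RingAutoGroup S\<lparr>carrier := G\<rparr>" "\<lambda>\<sigma>. restrict \<sigma> (carrier S)"
    using S.automorphisms_act_on_stable_subring[OF assms(3,4) S.carrier_is_subring stable_S] by simp
  have fix_R: "fixed_points G R = onR.fixed_ring"
    by (auto simp: fixed_points_def onR.fixed_ring_def)
  have fix_S: "fixed_points G (carrier S) = onS.fixed_ring"
    by (auto simp: fixed_points_def onS.fixed_ring_def)
  define RG where "RG = fixed_points G R"
  define SG where "SG = fixed_points G (carrier S)"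
  have RG_R: "RG \<subseteq> R" unfolding RG_def fixed_points_def by blast
  have SG: "subring SG S" unfolding SG_def fix_S by (rule onS.subring_fixed_ring)
  have dSG: "domain (S\<lparr>carrier := SG\<rparr>)" using S.subring_is_domain[OF SG] .
  have ring_iff: "subring T (S\<lparr>carrier := A\<rparr>) \<longleftrightarrow> subring T S \<and> T \<subseteq> A" if A: "subring A S" for T A
  proof (cases "T \<subseteq> A")
    case True
    then have "T \<subseteq> carrier S" using subringE(1)[OF A] by auto
    then show ?thesis
      using S.subring_iff[of T] ring.subring_iff[OF S.subring_is_ring[OF A], of T] True by simp
  next
    case False
    then show ?thesis using subringE(1)[of T "S\<lparr>carrier := A\<rparr>"] by auto
  qed
  have RG: "subring RG S"
    using onR.subring_fixed_ring ring_iff[OF R] unfolding RG_def fix_R by blast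
  have RG_SG: "RG \<subseteq> SG"
    using RE(1) unfolding RG_def SG_def fixed_points_def by auto
  have gd: "going_down RG (S\<lparr>carrier := T\<rparr>)" if T: "subring T S" "T \<subseteq> SG" "RG \<subseteq> T" for T
    unfolding going_down_def
  proof (intro allI impI, elim conjE)
    fix p1 p2 q2
    assume p: "primeideal p1 (S\<lparr>carrier := T, carrier := RG\<rparr>)"
      "primeideal p2 (S\<lparr>carrier := T, carrier := RG\<rparr>)" "p1 \<subseteq> p2"
      and q2: "primeideal q2 (S\<lparr>carrier := T\<rparr>)" "q2 \<inter> RG = p2"
    \<comment> \<open>The compositum of \<open>R\<close> and \<open>T\<close>: it lies over \<open>R\<close>, where the hypothesis applies, and is
      integral over \<open>T\<close>, so that \<open>q2\<close> can be lifted to it.\<close>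
    define A where "A = generate_ring S (R \<union> T)"
    have RT: "R \<union> T \<subseteq> carrier S" using RE(1) subringE(1)[OF T(1)] by simp
    have A: "subring A S" and RA: "R \<subseteq> A" and TA: "T \<subseteq> A"
      using S.generate_ringE[OF RT A_def] by auto
    interpret A: cring "S\<lparr>carrier := A\<rparr>"
      using S.subcring_iff[OF subringE(1)[OF A]] S.subcringI'[OF A] by simp
    have T_A: "subring T (S\<lparr>carrier := A\<rparr>)" using ring_iff[OF A] T(1) TA by blast
    have R_A: "subring R (S\<lparr>carrier := A\<rparr>)" using ring_iff[OF A] R RA by blast
    have "A \<subseteq> {a. A.integral_over T a}"
    proof -
      let ?C = "{a. A.integral_over T a}"
      have C_A: "subring ?C (S\<lparr>carrier := A\<rparr>)" by (rule A.subring_integral_closure[OF T_A])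
      then have C: "subring ?C S" using ring_iff[OF A] by blast
      have "R \<subseteq> ?C"
      proof
        fix r assume "r \<in> R"
        then have "onR.integral_over RG r"
          unfolding RG_def fix_R using onR.integral_over_fixed_ring by simp
        then show "r \<in> ?C"
          using S.integral_over_mono[OF R A RA T(3)] by simp
      qed
      moreover have "T \<subseteq> ?C" using A.integral_over_base[OF T_A] by blast
      ultimately show ?thesis
        using S.generate_ringE(3)[OF RT A_def C] by blast
    qed
    then have int: "A.integral_over T a" if "a \<in> carrier (S\<lparr>carrier := A\<rparr>)" for a
      using that by auto
    have "primeideal q2 (S\<lparr>carrier := A, carrier := T\<rparr>)" using q2(1) by simp
    from A.lying_over[OF T_A int this]
    obtain Q2 where Q2: "primeideal Q2 (S\<lparr>carrier := A\<rparr>)" "Q2 \<inter> T = q2" by blast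
    have P2: "primeideal (Q2 \<inter> R) (S\<lparr>carrier := R\<rparr>)"
      using A.primeideal_contract[OF R_A Q2(1)] by simp
    have P2_p2: "(Q2 \<inter> R) \<inter> RG = p2"
      using Q2(2) q2(2) RG_R T(3) by auto
    have "going_down RG (S\<lparr>carrier := R\<rparr>)"
      using onR.going_down_fixed_ring unfolding RG_def fix_R .
    then obtain P1 where P1: "primeideal P1 (S\<lparr>carrier := R\<rparr>)" "P1 \<subseteq> Q2 \<inter> R" "P1 \<inter> RG = p1"
      by (rule going_down_prime[OF _ P2]) (use p P2_p2 in simp_all)
    have "going_down R (S\<lparr>carrier := A\<rparr>)"
      using assms(6) A RA unfolding GD_pair_def by metis
    then obtain Q1 where Q1: "primeideal Q1 (S\<lparr>carrier := A\<rparr>)" "Q1 \<subseteq> Q2" "Q1 \<inter> R = P1"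
      by (rule going_down_prime[OF _ Q2(1)]) (use P1 P2 in simp_all)
    have "primeideal (Q1 \<inter> T) (S\<lparr>carrier := T\<rparr>)"
      using A.primeideal_contract[OF T_A Q1(1)] by simp
    moreover have "Q1 \<inter> T \<subseteq> q2" using Q1(2) Q2(2) by auto
    moreover have "(Q1 \<inter> T) \<inter> RG = p1" using Q1(3) P1(3) RG_R T(3) by auto
    ultimately show "\<exists>q1. primeideal q1 (S\<lparr>carrier := T\<rparr>) \<and> q1 \<subseteq> q2 \<and> q1 \<inter> RG = p1"
      by metis
  qed
  have "subdomain RG (S\<lparr>carrier := SG\<rparr>)"
    using domain.subdomainI'[OF dSG] ring_iff[OF SG] RG RG_SG by blast
  then have "GD_pair RG (S\<lparr>carrier := SG\<rparr>)"
    unfolding GD_pair_def using dSG gd ring_iff[OF SG] by simp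
  then show ?thesis unfolding RG_def SG_def .
qed

end
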